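(* Let $n\ge 2$, let $x_1,\dots,x_n\in\mathbb{R}$ with $\sum_{k=1}^n x_k\neq 0$, let $u>0$, and let $0<\delta<1$. Let $\delta_2,\dots,\delta_n$ be real random variables with $|\delta_k|\le u$ and $\mathbb{E}[\delta_k]=0$ for $2\le k\le n$, which are mean independent. Let $z_n=\sum_{k=1}^n x_k$ be the exact sum and let $\hat z_n$ be the sequentially computed floating point sum with roundoff errors $\delta_2,\dots,\delta_n$, where the absolute error is represented as $\hat z_n-z_n=Z=\sum_{k=2}^n Z_k$ with $Z_k=\delta_k\sum_{\ell=1}^k x_\ell$. Put $c_1=0$ and $c_k=u\sum_{\ell=1}^k|x_\ell|$ for $2\le k\le n$. Then with probability at least $1-\delta$, $$\left|\frac{\hat z_n-z_n}{z_n}\right|\le\frac{\sqrt{2\ln\frac{2}{\delta}}\,\sqrt{\sum_{k=1}^n c_k^2}}{|z_n|}.$$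
   Context: Sequential summation: the exact partial sums are $z_1=x_1$, $z_k=z_{k-1}+x_k$ for $2\le k\le n$. The computed partial sums are $\hat z_1=x_1$, $\hat z_k=(\hat z_{k-1}+x_k)(1+\delta_k)$ for $2\le k\le n$, where $\delta_k$ is the roundoff error of the $k$-th addition and $u>0$ is the unit roundoff; $\hat z_n$ is the sum computed in floating point arithmetic. The $x_k$ are deterministic constants. Mean independent means $\mathbb{E}[\delta_k\mid\delta_2,\dots,\delta_{k-1}]=\mathbb{E}[\delta_k]$ for each $k$. The paper represents the absolute error as $Z=\sum_{j=2}^n Z_j=\hat z_n-z_n$ with $Z_k=\delta_k\sum_{\ell=1}^k x_\ell$; this representation is a standing assumption of the statement. *)

theory Defs
  imports "HOL-Probability.Probability"
begin

text \<open>
  Summands \<open>x k\<close> and roundoff errors \<open>\<delta> k\<close> are indexed from 1 and 2, respectively; values at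
  smaller indices are irrelevant. The value of \<open>computed_sum\<close> at index 0 is a dummy.
\<close>

definition exact_sum :: "(nat \<Rightarrow> real) \<Rightarrow> nat \<Rightarrow> real" where
  "exact_sum x k = (\<Sum>l=1..k. x l)"

fun computed_sum :: "(nat \<Rightarrow> real) \<Rightarrow> (nat \<Rightarrow> real) \<Rightarrow> nat \<Rightarrow> real" where
  "computed_sum x d 0 = 0"
| "computed_sum x d (Suc 0) = x 1"
| "computed_sum x d (Suc (Suc k)) =
     (computed_sum x d (Suc k) + x (Suc (Suc k))) * (1 + d (Suc (Suc k)))"

text \<open>
  The representation \<open>Z = \<Sum>\<^sub>k Z\<^sub>k\<close> of the absolute error. Unfolding the recurrence gives
  \<open>\<Sum>k. \<delta> k * z k * (\<Prod>j>k. 1 + \<delta> j)\<close>, so equality with \<open>computed_sum x d n - exact_sum x n\<close>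
  holds only to first order in general.
\<close>

definition error_repr :: "(nat \<Rightarrow> real) \<Rightarrow> (nat \<Rightarrow> real) \<Rightarrow> nat \<Rightarrow> real" where
  "error_repr x d n = (\<Sum>k=2..n. d k * (\<Sum>l=1..k. x l))"

definition bound_coeff :: "real \<Rightarrow> (nat \<Rightarrow> real) \<Rightarrow> nat \<Rightarrow> real" where
  "bound_coeff u x k = (if k = 1 then 0 else u * (\<Sum>l=1..k. \<bar>x l\<bar>))"

text \<open>The sigma-algebra generated by the errors \<open>\<delta> 2, \<dots>, \<delta> (k - 1)\<close>; it is trivial for \<open>k = 2\<close>.\<close>

definition past_errors :: "'a measure \<Rightarrow> (nat \<Rightarrow> 'a \<Rightarrow> real) \<Rightarrow> nat \<Rightarrow> 'a measure" where
  "past_errors M \<delta> k =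
     vimage_algebra (space M) (\<lambda>\<omega>. \<lambda>j\<in>{2..<k}. \<delta> j \<omega>) (\<Pi>\<^sub>M j\<in>{2..<k}. (borel :: real measure))"

definition mean_independent :: "'a measure \<Rightarrow> (nat \<Rightarrow> 'a \<Rightarrow> real) \<Rightarrow> nat \<Rightarrow> bool" where
  "mean_independent M \<delta> n \<longleftrightarrow>
     (\<forall>k\<in>{2..n}. AE \<omega> in M.
        real_cond_exp M (past_errors M \<delta> k) (\<delta> k) \<omega> = integral\<^sup>L M (\<delta> k))"

end

theory Submission
  imports Defs
begin

text \<open>
  The terms \<open>Z\<^sub>k = \<delta>\<^sub>k (x\<^sub>1 + \<dots> + x\<^sub>k)\<close> of the absolute error are martingale differences: the second
  factor is a constant, and mean independence says that \<open>\<delta>\<^sub>k\<close> has conditional mean \<open>0\<close> given the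
  earlier errors. Since \<open>\<bar>Z\<^sub>k\<bar> \<le> c\<^sub>k\<close> almost surely, the Azuma--Hoeffding inequality bounds
  \<open>Prob (\<bar>Z\<bar> \<ge> \<epsilon>)\<close> by \<open>2 exp (- \<epsilon>\<^sup>2 / (2 \<Sum>\<^sub>k c\<^sub>k\<^sup>2))\<close>. The stated error bound, multiplied by \<open>\<bar>z\<^sub>n\<bar>\<close>, is the
  value of \<open>\<epsilon>\<close> that makes this bound equal to the admitted failure probability.

  The Azuma--Hoeffding inequality itself is an induction on the moment generating function of the
  partial sums \<open>S\<^sub>m\<close>. On \<open>[-c, c]\<close> the convex function \<open>y \<mapsto> exp (l y)\<close> lies below its chord, whose value
  at \<open>0\<close> is \<open>cosh (l c) \<le> exp (l\<^sup>2 c\<^sup>2 / 2)\<close> (\<open>exp_le_chord\<close>, \<open>cosh_le_exp_half_square\<close>). Replacing the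
  last factor of \<open>exp (l S\<^sub>m) exp (l D\<^sub>m)\<close> by the chord leaves a term proportional to
  \<open>exp (l S\<^sub>m) D\<^sub>m\<close>, whose mean vanishes because \<open>exp (l S\<^sub>m)\<close> is determined by the past
  (\<open>expectation_exp_partial_sum_mult_next\<close>). So each difference multiplies the bound by at most
  \<open>exp (l\<^sup>2 c\<^sub>m\<^sup>2 / 2)\<close>, and Chernoff's inequality with the best \<open>l\<close> turns this into the tail bound.
\<close>

section \<open>The hyperbolic cosine bound behind Hoeffding's lemma\<close>

text \<open>
  The auxiliary estimate of Hoeffding's lemma, at the symmetric two-point distribution on
  \<open>{-t, t}\<close>, whose moment generating function is a hyperbolic cosine.
\<close>

lemma cosh_le_exp_half_square:
  fixes t :: real
  shows "cosh t \<le> exp (t\<^sup>2 / 2)"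
proof -
  have pos: "cosh s \<le> exp (s\<^sup>2 / 2)" if "s \<ge> 0" for s :: real
  proof -
    have eq: "1 + 1/2 * (exp (2 * s) - 1) = exp s * cosh s"
      by (simp add: cosh_def algebra_simps flip: exp_add)
    have "ln (exp s * cosh s) = s + ln (cosh s)"
      by (simp add: ln_mult cosh_real_pos)
    then have "ln (cosh s) \<le> s\<^sup>2 / 2"
      using Hoeffdings_lemma_aux[of "2 * s" "1/2"] that unfolding eq
      by (simp add: power_mult_distrib)
    then show ?thesis
      by (metis cosh_real_pos exp_le_cancel_iff exp_ln)
  qed
  show ?thesis
    using pos[of "\<bar>t\<bar>"] by (simp add: cosh_real_abs)
qed

text \<open>
  Convexity on \<open>[-c, c]\<close>. Writing the chord as constant plus linear part separates what survives
  from what vanishes when \<open>y\<close> is replaced by a random variable of conditional mean \<open>0\<close>. For \<open>c = 0\<close>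
  the interval is a point, and the slope is \<open>0\<close> by the convention on division by \<open>0\<close>.
\<close>

lemma exp_le_chord:
  fixes l y c :: real
  assumes "\<bar>y\<bar> \<le> c"
  shows "exp (l * y) \<le> cosh (l * c) + sinh (l * c) / c * y"
proof (cases "c = 0")
  case True
  then show ?thesis using assms by simp
next
  case False
  then have c: "c > 0" using assms by linarith
  (* The weight for which y is the convex combination of the end points -c and c. *)
  define v where "v = (1 + y / c) / 2"
  have v: "0 \<le> v" "v \<le> 1"
    using assms c by (auto simp: v_def field_simps)
  have "exp ((1 - v) *\<^sub>R (- l * c) + v *\<^sub>R (l * c)) \<le> (1 - v) * exp (- l * c) + v * exp (l * c)"
    using convex_onD[OF convex_on_exp[of 1], of v "- l * c" "l * c"] v by simp
  also have "(1 - v) *\<^sub>R (- l * c) + v *\<^sub>R (l * c) = l * y"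
    using c by (simp add: v_def field_simps)
  also have "(1 - v) * exp (- l * c) + v * exp (l * c) = cosh (l * c) + sinh (l * c) / c * y"
    using c by (simp add: v_def cosh_def sinh_def field_simps)
  finally show ?thesis .
qed

section \<open>The Azuma--Hoeffding inequality\<close>

text \<open>
  The \<sigma>-algebras \<open>F i\<close> stand for the information available before the \<open>i\<close>-th step.
  The argument conditions on one of them at a time, and the fact about the past that it needs then is
  that all earlier differences are \<open>F i\<close>-measurable; this takes the place of a filtration.
\<close>

locale bounded_martingale_differences = prob_space M for M :: "'a measure" +
  fixes F :: "nat \<Rightarrow> 'a measure" and D :: "nat \<Rightarrow> 'a \<Rightarrow> real" and c :: "nat \<Rightarrow> real"
    and a b :: nat
  assumes subalg: "\<And>i. i \<in> {a..<b} \<Longrightarrow> subalgebra M (F i)"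
    and random_variable: "\<And>i. i \<in> {a..<b} \<Longrightarrow> D i \<in> borel_measurable M"
    and predictable: "\<And>i j. i \<in> {a..<b} \<Longrightarrow> j \<in> {a..<i} \<Longrightarrow> D j \<in> borel_measurable (F i)"
    and bounded: "\<And>i. i \<in> {a..<b} \<Longrightarrow> AE \<omega> in M. \<bar>D i \<omega>\<bar> \<le> c i"
    and cond_exp_zero: "\<And>i. i \<in> {a..<b} \<Longrightarrow> AE \<omega> in M. real_cond_exp M (F i) (D i) \<omega> = 0"
begin

text \<open>
  The symmetry that yields the lower tail from the upper one.
\<close>

lemma uminus: "bounded_martingale_differences M F (\<lambda>i \<omega>. - D i \<omega>) c a b"
proof unfold_locales
  fix i assume i: "i \<in> {a..<b}"
  interpret sub: finite_measure_subalgebra M "F i"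
    by unfold_locales (rule subalg[OF i])
  have [measurable]: "D i \<in> borel_measurable M" by (rule random_variable[OF i])
  have "integrable M (D i)"
    by (rule integrable_const_bound[of _ "c i"]) (use bounded[OF i] in auto)
  from sub.real_cond_exp_cmult[OF this, of "-1"] cond_exp_zero[OF i]
  show "AE \<omega> in M. real_cond_exp M (F i) (\<lambda>\<omega>. - D i \<omega>) \<omega> = 0"
    by eventually_elim simp
qed (use subalg random_variable predictable bounded in auto)

lemma random_variable_partial_sum:
  assumes "m \<le> b"
  shows "(\<lambda>\<omega>. \<Sum>i=a..<m. D i \<omega>) \<in> borel_measurable M"
  using assms by (intro borel_measurable_sum random_variable) auto

lemma AE_partial_sum_bounded:
  assumes "m \<le> b"
  shows "AE \<omega> in M. \<bar>\<Sum>i=a..<m. D i \<omega>\<bar> \<le> (\<Sum>i=a..<m. c i)"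
proof -
  have "AE \<omega> in M. \<forall>i\<in>{a..<m}. \<bar>D i \<omega>\<bar> \<le> c i"
    using assms bounded by (intro AE_finite_allI) auto
  then show ?thesis
    by eventually_elim (rule order_trans[OF sum_abs sum_mono], auto)
qed

lemma integrable_exp_partial_sum:
  assumes "m \<le> b"
  shows "integrable M (\<lambda>\<omega>. exp (l * (\<Sum>i=a..<m. D i \<omega>)))"
proof (rule integrable_const_bound[of _ "exp (\<bar>l\<bar> * (\<Sum>i=a..<m. c i))"])
  show "AE \<omega> in M. norm (exp (l * (\<Sum>i=a..<m. D i \<omega>))) \<le> exp (\<bar>l\<bar> * (\<Sum>i=a..<m. c i))"
    using AE_partial_sum_bounded[OF assms]
  proof eventually_elim
    case (elim \<omega>)
    have "l * (\<Sum>i=a..<m. D i \<omega>) \<le> \<bar>l\<bar> * \<bar>\<Sum>i=a..<m. D i \<omega>\<bar>"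
      by (metis abs_ge_self abs_mult)
    also have "\<dots> \<le> \<bar>l\<bar> * (\<Sum>i=a..<m. c i)"
      using elim by (intro mult_left_mono) auto
    finally show ?case by simp
  qed
qed (use random_variable_partial_sum[OF assms] in measurable)

text \<open>
  The only use of the martingale property: a function of the past is orthogonal to the next
  difference, since conditioning on \<open>F m\<close> allows \<open>D m\<close> to be replaced by its conditional mean.
\<close>

lemma expectation_exp_partial_sum_mult_next:
  assumes m: "m \<in> {a..<b}"
  shows "integrable M (\<lambda>\<omega>. exp (l * (\<Sum>i=a..<m. D i \<omega>)) * D m \<omega>)"
    and "expectation (\<lambda>\<omega>. exp (l * (\<Sum>i=a..<m. D i \<omega>)) * D m \<omega>) = 0"
proof -
  let ?W = "\<lambda>\<omega>. exp (l * (\<Sum>i=a..<m. D i \<omega>))"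
  interpret sub: finite_measure_subalgebra M "F m"
    by unfold_locales (rule subalg[OF m])
  have [measurable]: "D m \<in> borel_measurable M" by (rule random_variable[OF m])
  have "(\<lambda>\<omega>. \<Sum>i=a..<m. D i \<omega>) \<in> borel_measurable (F m)"
    by (intro borel_measurable_sum predictable[OF m])
  then have W: "?W \<in> borel_measurable (F m)" by measurable
  have intW: "integrable M ?W"
    using m by (intro integrable_exp_partial_sum) auto
  show int: "integrable M (\<lambda>\<omega>. ?W \<omega> * D m \<omega>)"
  proof (rule Bochner_Integration.integrable_bound)
    show "integrable M (\<lambda>\<omega>. c m * ?W \<omega>)" using intW by simp
    show "(\<lambda>\<omega>. ?W \<omega> * D m \<omega>) \<in> borel_measurable M"
      using intW by measurable
    show "AE \<omega> in M. norm (?W \<omega> * D m \<omega>) \<le> norm (c m * ?W \<omega>)"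
      using bounded[OF m] by eventually_elim (auto simp: abs_mult mult.commute)
  qed
  have "expectation (\<lambda>\<omega>. ?W \<omega> * D m \<omega>) = expectation (\<lambda>\<omega>. ?W \<omega> * real_cond_exp M (F m) (D m) \<omega>)"
    by (rule sub.real_cond_exp_intg(2)[OF int W, symmetric]) simp
  also have "\<dots> = expectation (\<lambda>\<omega>. 0)"
  proof (rule integral_cong_AE)
    show "AE \<omega> in M. ?W \<omega> * real_cond_exp M (F m) (D m) \<omega> = 0"
      using cond_exp_zero[OF m] by eventually_elim simp
    show "(\<lambda>\<omega>. ?W \<omega> * real_cond_exp M (F m) (D m) \<omega>) \<in> borel_measurable M"
      using intW by measurable
  qed simp
  finally show "expectation (\<lambda>\<omega>. ?W \<omega> * D m \<omega>) = 0" by simp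
qed

text \<open>
  Bounding the new factor \<open>exp (l * D m)\<close> by the chord over \<open>[- c m, c m]\<close>, the linear part of the
  chord contributes nothing in expectation by the preceding orthogonality.
\<close>

lemma expectation_exp_partial_sum_le:
  assumes "m \<le> b"
  shows "expectation (\<lambda>\<omega>. exp (l * (\<Sum>i=a..<m. D i \<omega>))) \<le> exp (l\<^sup>2 * (\<Sum>i=a..<m. (c i)\<^sup>2) / 2)"
  using assms
proof (induction m)
  case 0
  then show ?case by (simp add: prob_space)
next
  case (Suc m)
  show ?case
  proof (cases "a \<le> m")
    case False
    then show ?thesis by (simp add: prob_space)
  next
    case True
    then have m: "m \<in> {a..<b}" using Suc.prems by simp
    let ?W = "\<lambda>\<omega>. exp (l * (\<Sum>i=a..<m. D i \<omega>))"
    let ?r = "sinh (l * c m) / c m"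
    have intW: "integrable M ?W"
      using m by (intro integrable_exp_partial_sum) auto
    note next_zero = expectation_exp_partial_sum_mult_next[OF m, of l]
    have "expectation (\<lambda>\<omega>. exp (l * (\<Sum>i=a..<Suc m. D i \<omega>)))
        \<le> expectation (\<lambda>\<omega>. cosh (l * c m) * ?W \<omega> + ?r * (?W \<omega> * D m \<omega>))"
    proof (rule integral_mono_AE)
      show "integrable M (\<lambda>\<omega>. exp (l * (\<Sum>i=a..<Suc m. D i \<omega>)))"
        by (rule integrable_exp_partial_sum[OF Suc.prems])
      show "integrable M (\<lambda>\<omega>. cosh (l * c m) * ?W \<omega> + ?r * (?W \<omega> * D m \<omega>))"
        using intW next_zero(1) by (intro Bochner_Integration.integrable_add integrable_mult_right)
      show "AE \<omega> in M. exp (l * (\<Sum>i=a..<Suc m. D i \<omega>))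
          \<le> cosh (l * c m) * ?W \<omega> + ?r * (?W \<omega> * D m \<omega>)"
        using bounded[OF m]
      proof eventually_elim
        case (elim \<omega>)
        have "exp (l * (\<Sum>i=a..<Suc m. D i \<omega>)) = ?W \<omega> * exp (l * D m \<omega>)"
          using True by (simp add: distrib_left exp_add)
        also have "\<dots> \<le> ?W \<omega> * (cosh (l * c m) + ?r * D m \<omega>)"
          by (intro mult_left_mono exp_le_chord elim) auto
        finally show ?case by (simp add: algebra_simps)
      qed
    qed
    also have "\<dots> = cosh (l * c m) * expectation ?W"
      using intW next_zero by simp
    also have "\<dots> \<le> exp ((l * c m)\<^sup>2 / 2) * exp (l\<^sup>2 * (\<Sum>i=a..<m. (c i)\<^sup>2) / 2)"
      using Suc by (intro mult_mono cosh_le_exp_half_square) auto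
    also have "\<dots> = exp (l\<^sup>2 * (\<Sum>i=a..<Suc m. (c i)\<^sup>2) / 2)"
      using True by (simp add: power_mult_distrib field_simps flip: exp_add)
    finally show ?thesis .
  qed
qed

text \<open>
  Chernoff's inequality combined with the bound on the moment generating function.
\<close>

lemma Azuma_Hoeffding_ge:
  assumes "\<epsilon> \<ge> 0"
  shows "prob {\<omega>\<in>space M. (\<Sum>i=a..<b. D i \<omega>) \<ge> \<epsilon>} \<le> exp (- \<epsilon>\<^sup>2 / (2 * (\<Sum>i=a..<b. (c i)\<^sup>2)))"
proof -
  let ?S = "\<lambda>\<omega>. \<Sum>i=a..<b. D i \<omega>"
  define d where "d = (\<Sum>i=a..<b. (c i)\<^sup>2)"
  show ?thesis
  proof (cases "\<epsilon> = 0 \<or> d = 0")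
    case True
    (* The exponent is 0, for d = 0 by the convention on division by 0, so the bound is 1. *)
    then show ?thesis by (auto simp flip: d_def)
  next
    case False
    then have \<epsilon>: "\<epsilon> > 0" and d: "d > 0"
      using assms by (auto simp: d_def less_le sum_nonneg)
    (* The minimiser of the Chernoff exponent - l * \<epsilon> + l\<^sup>2 * d / 2. *)
    define l where "l = \<epsilon> / d"
    have l: "l > 0" using \<epsilon> d by (simp add: l_def)
    have "ennreal (prob {\<omega>\<in>space M. ?S \<omega> \<ge> \<epsilon>}) = emeasure M {\<omega>\<in>space M. ?S \<omega> \<ge> \<epsilon>}"
      by (simp add: emeasure_eq_measure)
    also have "\<dots> \<le> ennreal (exp (- l * \<epsilon>)) * (\<integral>\<^sup>+\<omega>\<in>space M. exp (l * ?S \<omega>) \<partial>M)"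
      using random_variable_partial_sum[of b] by (intro Chernoff_ineq_nn_integral_ge l) auto
    also have "(\<integral>\<^sup>+\<omega>\<in>space M. exp (l * ?S \<omega>) \<partial>M) = (\<integral>\<^sup>+\<omega>. exp (l * ?S \<omega>) \<partial>M)"
      by (intro nn_integral_cong) simp
    also have "\<dots> = ennreal (expectation (\<lambda>\<omega>. exp (l * ?S \<omega>)))"
      by (intro nn_integral_eq_integral integrable_exp_partial_sum) auto
    also have "ennreal (exp (- l * \<epsilon>)) * \<dots> \<le> ennreal (exp (- l * \<epsilon>)) * ennreal (exp (l\<^sup>2 * d / 2))"
      using expectation_exp_partial_sum_le[of b l]
      by (intro mult_left_mono ennreal_leI) (auto simp: d_def)
    also have "\<dots> = ennreal (exp (- \<epsilon>\<^sup>2 / (2 * d)))"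
    proof -
      have "- l * \<epsilon> + l\<^sup>2 * d / 2 = - \<epsilon>\<^sup>2 / (2 * d)"
        using d by (simp add: l_def field_simps power2_eq_square)
      then show ?thesis by (simp flip: ennreal_mult exp_add)
    qed
    finally show ?thesis by (simp add: d_def)
  qed
qed

lemma Azuma_Hoeffding_abs_ge:
  assumes "\<epsilon> \<ge> 0"
  shows "prob {\<omega>\<in>space M. \<bar>\<Sum>i=a..<b. D i \<omega>\<bar> \<ge> \<epsilon>} \<le> 2 * exp (- \<epsilon>\<^sup>2 / (2 * (\<Sum>i=a..<b. (c i)\<^sup>2)))"
proof -
  let ?S = "\<lambda>\<omega>. \<Sum>i=a..<b. D i \<omega>"
  interpret neg: bounded_martingale_differences M F "\<lambda>i \<omega>. - D i \<omega>" c a b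
    by (rule uminus)
  have [measurable]: "?S \<in> borel_measurable M"
    by (rule random_variable_partial_sum) simp
  have "prob {\<omega>\<in>space M. \<bar>?S \<omega>\<bar> \<ge> \<epsilon>}
      \<le> prob ({\<omega>\<in>space M. ?S \<omega> \<ge> \<epsilon>} \<union> {\<omega>\<in>space M. - ?S \<omega> \<ge> \<epsilon>})"
    by (rule finite_measure_mono) auto
  also have "\<dots> \<le> prob {\<omega>\<in>space M. ?S \<omega> \<ge> \<epsilon>} + prob {\<omega>\<in>space M. - ?S \<omega> \<ge> \<epsilon>}"
    by (rule measure_Un_le) auto
  finally show ?thesis
    using Azuma_Hoeffding_ge[OF assms] neg.Azuma_Hoeffding_ge[OF assms]
    by (simp add: sum_negf)
qed

text \<open>
  The two-sided tail bound solved for \<open>\<epsilon>\<close>: the deviation is chosen so that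
  \<open>2 * exp (- \<epsilon>\<^sup>2 / (2 * d)) = p\<close>. Solving this for \<open>\<epsilon>\<close> requires \<open>d = (\<Sum>i=a..<b. (c i)\<^sup>2)\<close> to be positive.
\<close>

lemma Azuma_Hoeffding_confidence:
  assumes p: "0 < p" "p \<le> 2" and pos: "(\<Sum>i=a..<b. (c i)\<^sup>2) > 0"
  shows "prob {\<omega>\<in>space M. \<bar>\<Sum>i=a..<b. D i \<omega>\<bar> \<le> sqrt (2 * ln (2 / p)) * sqrt (\<Sum>i=a..<b. (c i)\<^sup>2)} \<ge> 1 - p"
proof -
  let ?S = "\<lambda>\<omega>. \<Sum>i=a..<b. D i \<omega>"
  define d where "d = (\<Sum>i=a..<b. (c i)\<^sup>2)"
  define \<epsilon> where "\<epsilon> = sqrt (2 * ln (2 / p)) * sqrt d"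
  have ln: "ln (2 / p) \<ge> 0" using p by simp
  have d: "d > 0" using pos by (simp add: d_def)
  have "\<epsilon> \<ge> 0" using ln d by (simp add: \<epsilon>_def)
  have [measurable]: "?S \<in> borel_measurable M"
    by (rule random_variable_partial_sum) simp
  have "\<epsilon>\<^sup>2 = 2 * ln (2 / p) * d"
    using ln d by (simp add: \<epsilon>_def power_mult_distrib)
  then have "2 * exp (- \<epsilon>\<^sup>2 / (2 * d)) = 2 * exp (- ln (2 / p))"
    using d by simp
  also have "\<dots> = p"
    using p by (simp add: exp_minus)
  finally have "prob {\<omega>\<in>space M. \<bar>?S \<omega>\<bar> \<ge> \<epsilon>} \<le> p"
    using Azuma_Hoeffding_abs_ge[OF \<open>\<epsilon> \<ge> 0\<close>] by (simp add: d_def)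
  then have "1 - p \<le> prob (space M - {\<omega>\<in>space M. \<bar>?S \<omega>\<bar> \<ge> \<epsilon>})"
    by (subst prob_compl) auto
  also have "\<dots> \<le> prob {\<omega>\<in>space M. \<bar>?S \<omega>\<bar> \<le> \<epsilon>}"
    by (rule finite_measure_mono) auto
  finally show ?thesis by (simp add: \<epsilon>_def d_def)
qed

end

section \<open>Roundoff errors as martingale differences\<close>

lemma subalgebra_past_errors:
  assumes "\<And>j. j \<in> {2..<k} \<Longrightarrow> \<delta> j \<in> borel_measurable M"
  shows "subalgebra M (past_errors M \<delta> k)"
proof -
  have "(\<lambda>\<omega>. \<lambda>j\<in>{2..<k}. \<delta> j \<omega>) \<in> M \<rightarrow>\<^sub>M (\<Pi>\<^sub>M j\<in>{2..<k}. (borel :: real measure))"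
    using assms by (intro measurable_restrict) auto
  then have "sets (past_errors M \<delta> k) \<subseteq> sets M"
    unfolding past_errors_def
    by (subst sets_vimage_algebra2) (auto simp: space_PiM intro: measurable_sets)
  then show ?thesis
    by (simp add: subalgebra_def past_errors_def)
qed

lemma measurable_past_errors:
  assumes "j \<in> {2..<k}"
  shows "\<delta> j \<in> borel_measurable (past_errors M \<delta> k)"
proof -
  let ?h = "\<lambda>\<omega>. \<lambda>j\<in>{2..<k}. \<delta> j \<omega>"
  have "?h \<in> past_errors M \<delta> k \<rightarrow>\<^sub>M (\<Pi>\<^sub>M j\<in>{2..<k}. (borel :: real measure))"
    unfolding past_errors_def by (rule measurable_vimage_algebra1) (auto simp: space_PiM)
  from measurable_compose[OF this measurable_component_singleton[OF assms]]
  show ?thesis using assms by simp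
qed

lemma borel_measurable_computed_sum:
  assumes "\<And>j. j \<in> {2..k} \<Longrightarrow> \<delta> j \<in> borel_measurable M"
  shows "(\<lambda>\<omega>. computed_sum x (\<lambda>j. \<delta> j \<omega>) k) \<in> borel_measurable M"
  using assms
proof (induction k rule: induct_nat_012)
  case (ge2 k)
  have [measurable]: "\<delta> (Suc (Suc k)) \<in> borel_measurable M"
      "(\<lambda>\<omega>. computed_sum x (\<lambda>j. \<delta> j \<omega>) (Suc k)) \<in> borel_measurable M"
    using ge2 by auto
  show ?case by simp
qed auto

lemma abs_partial_sum_le_bound_coeff:
  assumes "k \<ge> 2" "\<bar>d\<bar> \<le> u"
  shows "\<bar>d * (\<Sum>l=1..k. x l)\<bar> \<le> bound_coeff u x k"
  using assms unfolding bound_coeff_def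
  by (auto simp: abs_mult intro!: mult_mono sum_abs)

text \<open>
  The factor \<open>\<Sum>l=1..k. x l\<close> of each error term is deterministic, so it can be pulled out of the
  conditional expectation, where mean independence and the vanishing mean give \<open>0\<close>.
\<close>

lemma error_terms_bounded_martingale_differences:
  assumes "prob_space M"
    and meas: "\<And>k. k \<in> {2..n} \<Longrightarrow> \<delta> k \<in> borel_measurable M"
    and bdd: "\<And>k. k \<in> {2..n} \<Longrightarrow> AE \<omega> in M. \<bar>\<delta> k \<omega>\<bar> \<le> u"
    and zero: "\<And>k. k \<in> {2..n} \<Longrightarrow> integral\<^sup>L M (\<delta> k) = 0"
    and "mean_independent M \<delta> n"
  shows "bounded_martingale_differences M (past_errors M \<delta>)
           (\<lambda>k \<omega>. \<delta> k \<omega> * (\<Sum>l=1..k. x l)) (bound_coeff u x) 2 (Suc n)"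
proof -
  interpret prob_space M by fact
  show ?thesis
  proof unfold_locales
    fix k assume k: "k \<in> {2..<Suc n}"
    then show sub: "subalgebra M (past_errors M \<delta> k)"
      by (intro subalgebra_past_errors meas) auto
    have [measurable]: "\<delta> k \<in> borel_measurable M" using meas k by auto
    show "(\<lambda>\<omega>. \<delta> k \<omega> * (\<Sum>l=1..k. x l)) \<in> borel_measurable M" by measurable
    have bdd_k: "AE \<omega> in M. \<bar>\<delta> k \<omega>\<bar> \<le> u" using bdd k by auto
    then show "AE \<omega> in M. \<bar>\<delta> k \<omega> * (\<Sum>l=1..k. x l)\<bar> \<le> bound_coeff u x k"
      by eventually_elim (rule abs_partial_sum_le_bound_coeff, use k in auto)
    interpret sub: finite_measure_subalgebra M "past_errors M \<delta> k"
      by unfold_locales (rule sub)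
    have "integrable M (\<delta> k)"
      by (rule integrable_const_bound[of _ u]) (use bdd_k in auto)
    from sub.real_cond_exp_cmult[OF this, of "\<Sum>l=1..k. x l"]
    have "AE \<omega> in M. real_cond_exp M (past_errors M \<delta> k) (\<lambda>\<omega>. \<delta> k \<omega> * (\<Sum>l=1..k. x l)) \<omega>
        = (\<Sum>l=1..k. x l) * real_cond_exp M (past_errors M \<delta> k) (\<delta> k) \<omega>"
      by (simp add: mult.commute)
    moreover have "AE \<omega> in M. real_cond_exp M (past_errors M \<delta> k) (\<delta> k) \<omega> = 0"
    proof -
      have "k \<in> {2..n}" using k by auto
      with \<open>mean_independent M \<delta> n\<close>
      have "AE \<omega> in M. real_cond_exp M (past_errors M \<delta> k) (\<delta> k) \<omega> = integral\<^sup>L M (\<delta> k)"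
        unfolding mean_independent_def by (rule bspec)
      then show ?thesis unfolding zero[OF \<open>k \<in> {2..n}\<close>] .
    qed
    ultimately show "AE \<omega> in M.
        real_cond_exp M (past_errors M \<delta> k) (\<lambda>\<omega>. \<delta> k \<omega> * (\<Sum>l=1..k. x l)) \<omega> = 0"
      by eventually_elim simp
  next
    fix k j :: nat assume "j \<in> {2..<k}"
    from measurable_past_errors[OF this, of \<delta> M]
    show "(\<lambda>\<omega>. \<delta> j \<omega> * (\<Sum>l=1..j. x l)) \<in> borel_measurable (past_errors M \<delta> k)"
      by measurable
  qed
qed

lemma sum_bound_coeff_square:
  "(\<Sum>k=1..n. (bound_coeff u x k)\<^sup>2) = (\<Sum>k=2..<Suc n. (bound_coeff u x k)\<^sup>2)"
  by (rule sum.mono_neutral_right) (auto simp: bound_coeff_def)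

text \<open>
  The last coefficient dominates \<open>u * \<bar>exact_sum x n\<bar>\<close>, so a nonzero exact sum excludes the degenerate
  case in which all bounds vanish.
\<close>

lemma sum_bound_coeff_square_pos:
  assumes "n \<ge> 2" "exact_sum x n \<noteq> 0" "u > 0"
  shows "(\<Sum>k=2..<Suc n. (bound_coeff u x k)\<^sup>2) > 0"
proof -
  have "0 < \<bar>exact_sum x n\<bar>" using assms by simp
  also have "\<dots> \<le> (\<Sum>l=1..n. \<bar>x l\<bar>)"
    unfolding exact_sum_def by (rule sum_abs)
  finally have "bound_coeff u x n > 0"
    using assms by (simp add: bound_coeff_def)
  then show ?thesis
    using assms by (intro sum_pos2[of _ n]) auto
qed

text \<open>
  Multiplication by \<open>\<bar>exact_sum x n\<bar>\<close> reduces both claims to a bound on the absolute error. For the second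
  conjunct this is the Azuma--Hoeffding bound on \<open>Z\<close>, and it transfers to the computed sum because
  almost surely equal errors give events of equal probability.
\<close>

theorem theorem5p2:
  fixes M :: "'a measure"
    and \<delta> :: "nat \<Rightarrow> 'a \<Rightarrow> real"
    and x :: "nat \<Rightarrow> real"
    and u p :: real
    and n :: nat
  assumes "prob_space M"
    and "n \<ge> 2"
    and "exact_sum x n \<noteq> 0"
    and "u > 0"
    and "0 < p" and "p < 1"
    and "\<And>k. k \<in> {2..n} \<Longrightarrow> \<delta> k \<in> borel_measurable M"
    and "\<And>k. k \<in> {2..n} \<Longrightarrow> AE \<omega> in M. \<bar>\<delta> k \<omega>\<bar> \<le> u"
    and "\<And>k. k \<in> {2..n} \<Longrightarrow> integral\<^sup>L M (\<delta> k) = 0"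
    and "mean_independent M \<delta> n"
  shows
    "((AE \<omega> in M. computed_sum x (\<lambda>k. \<delta> k \<omega>) n - exact_sum x n = error_repr x (\<lambda>k. \<delta> k \<omega>) n) \<longrightarrow>
       measure M {\<omega> \<in> space M.
         \<bar>(computed_sum x (\<lambda>k. \<delta> k \<omega>) n - exact_sum x n) / exact_sum x n\<bar>
           \<le> sqrt (2 * ln (2 / p)) * sqrt (\<Sum>k=1..n. (bound_coeff u x k)\<^sup>2) / \<bar>exact_sum x n\<bar>}
       \<ge> 1 - p)
     \<and> measure M {\<omega> \<in> space M.
         \<bar>error_repr x (\<lambda>k. \<delta> k \<omega>) n / exact_sum x n\<bar>
           \<le> sqrt (2 * ln (2 / p)) * sqrt (\<Sum>k=1..n. (bound_coeff u x k)\<^sup>2) / \<bar>exact_sum x n\<bar>}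
       \<ge> 1 - p"
proof -
  interpret prob_space M by fact
  let ?z = "exact_sum x n"
  let ?Z = "\<lambda>\<omega>. error_repr x (\<lambda>k. \<delta> k \<omega>) n"
  let ?E = "\<lambda>\<omega>. computed_sum x (\<lambda>k. \<delta> k \<omega>) n - ?z"
  let ?B = "sqrt (2 * ln (2 / p)) * sqrt (\<Sum>k=1..n. (bound_coeff u x k)\<^sup>2)"
  have [measurable]: "\<delta> k \<in> borel_measurable M" if "k \<in> {2..n}" for k
    using assms(7) that .
  have Z_meas [measurable]: "?Z \<in> borel_measurable M"
    unfolding error_repr_def by measurable
  have E_meas [measurable]: "?E \<in> borel_measurable M"
    using borel_measurable_computed_sum[of n \<delta> M x] by measurable
  interpret Z: bounded_martingale_differences M "past_errors M \<delta>"
      "\<lambda>k \<omega>. \<delta> k \<omega> * (\<Sum>l=1..k. x l)" "bound_coeff u x" 2 "Suc n"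
    by (intro error_terms_bounded_martingale_differences assms)
  have relative: "\<bar>y / ?z\<bar> \<le> ?B / \<bar>?z\<bar> \<longleftrightarrow> \<bar>y\<bar> \<le> ?B" for y :: real
    using assms(3) by (simp add: divide_le_cancel)
  have Z_eq: "?Z \<omega> = (\<Sum>k=2..<Suc n. \<delta> k \<omega> * (\<Sum>l=1..k. x l))" for \<omega>
    by (simp add: error_repr_def atLeastLessThanSuc_atLeastAtMost)
  have Z_bound: "1 - p \<le> prob {\<omega> \<in> space M. \<bar>?Z \<omega> / ?z\<bar> \<le> ?B / \<bar>?z\<bar>}"
    unfolding relative unfolding Z_eq sum_bound_coeff_square using assms(5,6)
    by (intro Z.Azuma_Hoeffding_confidence sum_bound_coeff_square_pos assms(2-4)) auto
  have "1 - p \<le> prob {\<omega> \<in> space M. \<bar>?E \<omega> / ?z\<bar> \<le> ?B / \<bar>?z\<bar>}"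
    if "AE \<omega> in M. ?E \<omega> = ?Z \<omega>"
  proof -
    have "prob {\<omega> \<in> space M. \<bar>?E \<omega> / ?z\<bar> \<le> ?B / \<bar>?z\<bar>} = prob {\<omega> \<in> space M. \<bar>?Z \<omega> / ?z\<bar> \<le> ?B / \<bar>?z\<bar>}"
      by (rule prob_eq_AE) (use that in auto)
    with Z_bound show ?thesis by simp
  qed
  with Z_bound show ?thesis by blast
qed

end
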